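(* Let $\tau_i$ be an atomic constraint with finite nonempty candidate pool $\mathcal{C}_i^{top}$ and real candidate scores $\{z_{i,c}\}_{c\in\mathcal{C}_i^{top}}$, let $\{p_{i,c}\}_{c\in\mathcal{C}_i^{top}}$ be the probability distribution on $\mathcal{C}_i^{top}$ obtained from these scores by softmax, and let $\gamma$ be a real threshold. If the sufficiency check accepts $\tau_i$, i.e. if $N_{\mathrm{eff}}(\tau_i)\le\gamma$, then $$\max_{c\in\mathcal{C}_i^{top}} p_{i,c}\ \ge\ \frac{1}{\gamma}.$$
   Context: For the purposes of this statement, an atomic constraint $\tau_i$ is just an index to which are attached a finite nonempty set $\mathcal{C}_i^{top}$ (the candidate pool) and real scores $z_{i,c}$, $c\in\mathcal{C}_i^{top}$. The associated candidate distribution is the softmax $p_{i,c}=e^{z_{i,c}}/\sum_{c'\in\mathcal{C}_i^{top}}e^{z_{i,c'}}$. The effective number of candidates is $$N_{\mathrm{eff}}(\tau_i)=\frac{1}{\sum_{c\in\mathcal{C}_i^{top}}p_{i,c}^2}.$$ The sufficiency check with threshold $\gamma$ accepts $\tau_i$ exactly when $N_{\mathrm{eff}}(\tau_i)\le\gamma$. *)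

theory Defs
  imports Complex_Main
begin

text \<open>
  An atomic constraint is an index \<open>i\<close> carrying a candidate pool \<open>C i\<close> and scores \<open>z i c\<close>,
  which are meaningful only for \<open>c \<in> C i\<close>.
\<close>

definition cand_prob :: "('i \<Rightarrow> 'c set) \<Rightarrow> ('i \<Rightarrow> 'c \<Rightarrow> real) \<Rightarrow> 'i \<Rightarrow> 'c \<Rightarrow> real" where
  "cand_prob C z i c = exp (z i c) / (\<Sum>c'\<in>C i. exp (z i c'))"

definition N_eff :: "('i \<Rightarrow> 'c set) \<Rightarrow> ('i \<Rightarrow> 'c \<Rightarrow> real) \<Rightarrow> 'i \<Rightarrow> real" where
  "N_eff C z i = 1 / (\<Sum>c\<in>C i. (cand_prob C z i c)\<^sup>2)"

definition accepts :: "('i \<Rightarrow> 'c set) \<Rightarrow> ('i \<Rightarrow> 'c \<Rightarrow> real) \<Rightarrow> real \<Rightarrow> 'i \<Rightarrow> bool" where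
  "accepts C z \<gamma> i \<longleftrightarrow> N_eff C z i \<le> \<gamma>"

end

theory Submission
  imports Defs
begin

text \<open>Let S be the sum of the squared candidate probabilities. It is the mean of the values
  p_c under the weights p_c themselves, so it cannot exceed the largest p_c
  (\<open>sum_squares_le_Max\<close>). Acceptance says 1/S \<le> \<gamma>, and since S > 0 this
  inverts to 1/\<gamma> \<le> S. Softmax enters through positivity (\<open>cand_prob_pos\<close>)
  and total mass 1 (\<open>sum_cand_prob\<close>).\<close>

lemma sum_exp_pos:
  fixes f :: "'a \<Rightarrow> real"
  assumes "finite A" and "A \<noteq> {}"
  shows "(\<Sum>a\<in>A. exp (f a)) > 0"
  using assms by (simp add: sum_pos)

lemma cand_prob_pos:
  assumes "finite (C i)" and "C i \<noteq> {}"
  shows "cand_prob C z i c > 0"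
  using sum_exp_pos[OF assms] by (simp add: cand_prob_def)

lemma sum_cand_prob:
  assumes "finite (C i)" and "C i \<noteq> {}"
  shows "(\<Sum>c\<in>C i. cand_prob C z i c) = 1"
  using sum_exp_pos[OF assms, of "z i"] by (simp add: cand_prob_def flip: sum_divide_distrib)

text \<open>In each square one factor is bounded by the maximum and the other is kept as a
  nonnegative weight; the weights add up to 1.\<close>

lemma sum_squares_le_Max:
  fixes p :: "'a \<Rightarrow> real"
  assumes "finite A" and "\<And>a. a \<in> A \<Longrightarrow> p a \<ge> 0" and "sum p A = 1"
  shows "(\<Sum>a\<in>A. (p a)\<^sup>2) \<le> Max (p ` A)"
proof -
  have "(\<Sum>a\<in>A. (p a)\<^sup>2) \<le> (\<Sum>a\<in>A. Max (p ` A) * p a)"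
    using assms(1,2) by (intro sum_mono) (simp add: power2_eq_square mult_right_mono)
  also have "\<dots> = Max (p ` A)"
    using assms(3) by (simp flip: sum_distrib_left)
  finally show ?thesis .
qed

theorem propositionB3:
  fixes C :: "'i \<Rightarrow> 'c set"
    and z :: "'i \<Rightarrow> 'c \<Rightarrow> real"
    and \<gamma> :: real
    and i :: 'i
  assumes "finite (C i)"
    and "C i \<noteq> {}"
    and "accepts C z \<gamma> i"
  shows "Max ((\<lambda>c. cand_prob C z i c) ` C i) \<ge> 1 / \<gamma>"
proof -
  define S where "S = (\<Sum>c\<in>C i. (cand_prob C z i c)\<^sup>2)"
  have "S > 0"
    unfolding S_def using assms(1,2) cand_prob_pos[of C i z]
    by (intro sum_pos zero_less_power) simp_all
  moreover have "1 / S \<le> \<gamma>"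
    using assms(3) by (simp add: accepts_def N_eff_def S_def)
  \<comment> \<open>Inversion reverses the order because 0 < 1/S; together with 1/S \<le> \<gamma>
    this also forces \<gamma> > 0.\<close>
  ultimately have "1 / \<gamma> \<le> S"
    using le_imp_inverse_le[of "1 / S" \<gamma>] by (simp add: inverse_eq_divide)
  also have "S \<le> Max ((\<lambda>c. cand_prob C z i c) ` C i)"
    unfolding S_def using assms(1,2)
    by (simp add: sum_squares_le_Max sum_cand_prob less_imp_le[OF cand_prob_pos])
  finally show ?thesis .
qed

end
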